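(* Let $\mathcal{A}=\{0,1,2\}$ and, for $k=1,\dots,18$, let $f_k:\mathcal{A}^2\to\mathcal{A}$ be the local functions (semigroup operations) listed in the context, with associated global functions $F_k:\mathcal{A}^{\mathbb{Z}}\to\mathcal{A}^{\mathbb{Z}}$, $[F_k(x)]_i=f_k(x_i,x_{i+1})$. Then for every configuration $x\in\mathcal{A}^{\mathbb{Z}}$, every $i\in\mathbb{Z}$ and every integer $n\ge 1$, the state of cell $i$ after $n$ iterations of $F_k$ is given by the following explicit formulae: \begin{align*} [F_1^n(x)]_i&=\Big(\sum_{j=0}^{n}\binom{n}{j}x_{i+j}\Big)\bmod 3,\\ [F_2^n(x)]_i&=1+\prod_{j=0}^{n}(x_{i+j}^2-x_{i+j}-1)^{\binom{n}{j}},\\ [F_3^n(x)]_i&=\begin{cases}2x_i(x_i-2)x_{i+1}(x_{i+1}-2)& n=1,\\ 0& n>1,\end{cases}\\ [F_4^n(x)]_i&=1+\prod_{j=0}^{n}(x_{i+j}-1)^{\binom{n}{j}},\\ [F_5^n(x)]_i&=1+\prod_{j=0}^{n}(x_{i+j}^2-3x_{i+j}+1)^{\binom{n}{j}}-\prod_{j=0}^{n}x_{i+j}(2-x_{i+j}),\\ [F_6^n(x)]_i&=1+\prod_{j=0}^{n}(x_{i+j}^2-3x_{i+j}+1)^{\binom{n}{j}},\\ [F_7^n(x)]_i&=2,\\ [F_8^n(x)]_i&=\prod_{j=0}^{n}x_{i+j}(2-x_{i+j}),\\ [F_9^n(x)]_i&=\prod_{j=0}^{n}\tfrac12 x_{i+j}(3-x_{i+j}),\\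 [F_{10}^n(x)]_i&=x_i x_{i+n}(x_i+x_{i+n}-x_i x_{i+n})\prod_{j=1}^{n-1}x_{i+j}(2-x_{i+j}),\\ [F_{11}^n(x)]_i&=1+(x_i-1)^2,\\ [F_{12}^n(x)]_i&=x_{i+n}\prod_{j=0}^{n-1}x_{i+j}(2-x_{i+j}),\\ [F_{13}^n(x)]_i&=\max\{x_{i+j}: j=0,1,\dots,n\},\\ [F_{14}^n(x)]_i&=\prod_{j=0}^{n}x_{i+j}(2-x_{i+j})+2\prod_{j=0}^{n}\tfrac12x_{i+j}(x_{i+j}-1),\\ [F_{15}^n(x)]_i&=x_i(2-x_i)+2\prod_{j=0}^{n}\tfrac12x_{i+j}(x_{i+j}-1),\\ [F_{16}^n(x)]_i&=1+(x_i-1)\prod_{j=1}^{n}(x_{i+j}-1)^2,\\ [F_{17}^n(x)]_i&=x_i,\\ [F_{18}^n(x)]_i&=1-\prod_{k=0}^{n}\big(1-H(i,k)\big)+2\prod_{j=0}^{n}\tfrac12x_{i+j}(x_{i+j}-1), \end{align*} where $H(i,0)=x_i(2-x_i)$ and, for $m>0$, $H(i,m)=x_{i+m}(2-x_{i+m})\prod_{j=0}^{m-1}\tfrac12x_{i+j}(x_{i+j}-1)$.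
   Context: A configuration is a bi-infinite sequence $x=(x_i)_{i\in\mathbb{Z}}\in\mathcal{A}^{\mathbb{Z}}$, with $\mathcal{A}=\{0,1,2\}$. For a local function $f:\mathcal{A}^2\to\mathcal{A}$ the global function of the cellular automaton is $F:\mathcal{A}^{\mathbb{Z}}\to\mathcal{A}^{\mathbb{Z}}$, $[F(x)]_i=f(x_i,x_{i+1})$, and $F^n$ is its $n$-th iterate. Up to isomorphism and anti-isomorphism there are 18 semigroups with three elements; realised on $\{0,1,2\}$, their operations $u\odot v=f_k(u,v)$, $k=1,\dots,18$, are the following (for $u,v\in\{0,1,2\}$; all arithmetic is ordinary rational arithmetic, except for the explicit "mod 3" for $k=1$, where the residue is taken in $\{0,1,2\}$): \begin{itemize} \item $f_1(u,v)=(u+v)\bmod 3$ \item $f_2(u,v)=1+(v^2-v-1)(u^2-u-1)$ \item $f_3(u,v)=2u(u-2)v(v-2)$ \item $f_4(u,v)=1+(v-1)(u-1)$ \item $f_5(u,v)=2-(u+v-3)(uv-u-v)$ \item $f_6(u,v)=1+(v^2-3v+1)(u^2-3u+1)$ \item $f_7(u,v)=2$ \item $f_8(u,v)=u(u-2)v(v-2)$ \item $f_9(u,v)=\frac14uv(v-3)(u-3)$ \item $f_{10}(u,v)=uv(u+v-uv)$ \item $f_{11}(u,v)=1+(u-1)^2$ \item $f_{12}(u,v)=uv(2-u)$ \item $f_{13}(u,v)=\max(u,v)$ \item $f_{14}(u,v)=\frac12uv(3uv-5u-5v+9)$ \item $f_{15}(u,v)=\frac12u(uv^2-uv-v^2-2u+v+4)$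 \item $f_{16}(u,v)=1+(v-1)^2(u-1)$ \item $f_{17}(u,v)=u$ \item $f_{18}(u,v)=\frac12u(uv-2u-v+4)$ \end{itemize} Each of these takes values in $\{0,1,2\}$ when $u,v\in\{0,1,2\}$. In the formulae of the claim, powers, products and sums are ordinary arithmetic ones, and an empty product equals $1$. *)

theory Defs
  imports Complex_Main
begin

(* States are rational numbers, so that the local rules can be written with ordinary
   rational arithmetic; only the three states below are meaningful. *)
definition alphabet :: "rat set" where
  "alphabet = {0, 1, 2}"

definition configurations :: "(int \<Rightarrow> rat) set" where
  "configurations = {x. \<forall>i. x i \<in> alphabet}"

definition global_map :: "(rat \<Rightarrow> rat \<Rightarrow> rat) \<Rightarrow> (int \<Rightarrow> rat) \<Rightarrow> (int \<Rightarrow> rat)" where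
  "global_map f x = (\<lambda>i. f (x i) (x (i + 1)))"

(* Residue in {0,1,2} of an integer-valued rational; the floor only converts to type int. *)
definition mod3 :: "rat \<Rightarrow> rat" where
  "mod3 a = of_int (\<lfloor>a\<rfloor> mod 3)"

lemma mod3_of_int: "mod3 (of_int m) = of_int (m mod 3)"
  by (simp add: mod3_def)

definition f1 :: "rat \<Rightarrow> rat \<Rightarrow> rat" where
  "f1 u v = mod3 (u + v)"

definition f2 :: "rat \<Rightarrow> rat \<Rightarrow> rat" where
  "f2 u v = 1 + (v^2 - v - 1) * (u^2 - u - 1)"

definition f3 :: "rat \<Rightarrow> rat \<Rightarrow> rat" where
  "f3 u v = 2 * u * (u - 2) * v * (v - 2)"

definition f4 :: "rat \<Rightarrow> rat \<Rightarrow> rat" where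
  "f4 u v = 1 + (v - 1) * (u - 1)"

definition f5 :: "rat \<Rightarrow> rat \<Rightarrow> rat" where
  "f5 u v = 2 - (u + v - 3) * (u * v - u - v)"

definition f6 :: "rat \<Rightarrow> rat \<Rightarrow> rat" where
  "f6 u v = 1 + (v^2 - 3 * v + 1) * (u^2 - 3 * u + 1)"

definition f7 :: "rat \<Rightarrow> rat \<Rightarrow> rat" where
  "f7 u v = 2"

definition f8 :: "rat \<Rightarrow> rat \<Rightarrow> rat" where
  "f8 u v = u * (u - 2) * v * (v - 2)"

definition f9 :: "rat \<Rightarrow> rat \<Rightarrow> rat" where
  "f9 u v = 1/4 * u * v * (v - 3) * (u - 3)"

definition f10 :: "rat \<Rightarrow> rat \<Rightarrow> rat" where
  "f10 u v = u * v * (u + v - u * v)"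

definition f11 :: "rat \<Rightarrow> rat \<Rightarrow> rat" where
  "f11 u v = 1 + (u - 1)^2"

definition f12 :: "rat \<Rightarrow> rat \<Rightarrow> rat" where
  "f12 u v = u * v * (2 - u)"

definition f13 :: "rat \<Rightarrow> rat \<Rightarrow> rat" where
  "f13 u v = max u v"

definition f14 :: "rat \<Rightarrow> rat \<Rightarrow> rat" where
  "f14 u v = 1/2 * u * v * (3 * u * v - 5 * u - 5 * v + 9)"

definition f15 :: "rat \<Rightarrow> rat \<Rightarrow> rat" where
  "f15 u v = 1/2 * u * (u * v^2 - u * v - v^2 - 2 * u + v + 4)"

definition f16 :: "rat \<Rightarrow> rat \<Rightarrow> rat" where
  "f16 u v = 1 + (v - 1)^2 * (u - 1)"

definition f17 :: "rat \<Rightarrow> rat \<Rightarrow> rat" where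
  "f17 u v = u"

definition f18 :: "rat \<Rightarrow> rat \<Rightarrow> rat" where
  "f18 u v = 1/2 * u * (u * v - 2 * u - v + 4)"

lemmas local_rule_defs =
  f1_def f2_def f3_def f4_def f5_def f6_def f7_def f8_def f9_def
  f10_def f11_def f12_def f13_def f14_def f15_def f16_def f17_def f18_def

lemma local_rules_closed:
  assumes "u \<in> alphabet" "v \<in> alphabet"
    and "f \<in> {f1, f2, f3, f4, f5, f6, f7, f8, f9,
               f10, f11, f12, f13, f14, f15, f16, f17, f18}"
  shows "f u v \<in> alphabet"
  using assms
  by (auto simp: alphabet_def local_rule_defs mod3_def power2_eq_square)

lemma global_map_configurations:
  assumes "x \<in> configurations"
    and "f \<in> {f1, f2, f3, f4, f5, f6, f7, f8, f9,
               f10, f11, f12, f13, f14, f15, f16, f17, f18}"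
  shows "global_map f x \<in> configurations"
  using assms local_rules_closed unfolding configurations_def global_map_def by blast

definition H :: "(int \<Rightarrow> rat) \<Rightarrow> int \<Rightarrow> nat \<Rightarrow> rat" where
  "H x i m =
    (if m = 0 then x i * (2 - x i)
     else x (i + int m) * (2 - x (i + int m)) *
       (\<Prod>j=0..m-1. 1/2 * x (i + int j) * (x (i + int j) - 1)))"

end

theory Submission
  imports Defs
begin

text \<open>A map \<open>\<phi>\<close> from the states to a commutative monoid with
  \<open>\<phi> (f u v) = \<phi> u * \<phi> v\<close> turns the automaton into the multiplicative Pascal rule, so
  \<open>\<phi>\<close> of the state after \<open>n\<close> steps is a product with binomial exponents; the exponents
  disappear when \<open>\<phi>\<close> takes the values 0 and 1 only. Such characters determine most of the rules.
  The semigroups 12, 13, 15, 16 and 18 satisfy \<open>abby = aby\<close>, which gives the one-sided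
  recursion \<open>F\<^sup>n\<^sup>+\<^sup>1(x)\<^sub>i = f(x\<^sub>i, F\<^sup>n(x)\<^sub>i\<^sub>+\<^sub>1)\<close>.\<close>

section \<open>Closed rules and their orbits\<close>

definition closed_rule :: "(rat \<Rightarrow> rat \<Rightarrow> rat) \<Rightarrow> bool" where
  "closed_rule f \<longleftrightarrow> (\<forall>u\<in>alphabet. \<forall>v\<in>alphabet. f u v \<in> alphabet)"

lemma closed_ruleI:
  assumes "f \<in> {f1, f2, f3, f4, f5, f6, f7, f8, f9,
                f10, f11, f12, f13, f14, f15, f16, f17, f18}"
  shows "closed_rule f"
  unfolding closed_rule_def using local_rules_closed[OF _ _ assms] by blast

lemma configurationsD: "x \<in> configurations \<Longrightarrow> x i \<in> alphabet"
  by (simp add: configurations_def)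

lemma global_map_in_configurations:
  assumes "closed_rule f" "x \<in> configurations"
  shows "global_map f x \<in> configurations"
  using assms by (auto simp: closed_rule_def configurations_def global_map_def)

lemma orbit_in_configurations:
  assumes "closed_rule f" "x \<in> configurations"
  shows "(global_map f ^^ n) x \<in> configurations"
  by (induction n) (use assms global_map_in_configurations in auto)

lemmas orbit_in_alphabet = configurationsD[OF orbit_in_configurations]

lemma global_map_funpow_Suc:
  "(global_map f ^^ Suc n) x i = f ((global_map f ^^ n) x i) ((global_map f ^^ n) x (i + 1))"
  by (simp add: global_map_def)

lemma alphabet_cases:
  assumes "u \<in> alphabet"
  obtains "u = 0" | "u = 1" | "u = 2"
  using assms by (auto simp: alphabet_def)

section \<open>Pascal recursion, characters and the one-sided recursion\<close>

lemma prod_head: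
  fixes a :: "int \<Rightarrow> rat"
  shows "(\<Prod>j=0..Suc n. a (i + int j)) = a i * (\<Prod>j=0..n. a (i + 1 + int j))"
  by (subst prod.atLeast0_atMost_Suc_shift) (simp add: add.assoc)

lemma prod_zero_one:
  fixes a :: "'b \<Rightarrow> rat"
  assumes "\<And>j. a j \<in> {0, 1}"
  shows "prod a A \<in> {0, 1}"
proof (induction A rule: infinite_finite_induct)
  case (insert j A)
  then show ?case using assms[of j] by (elim insertE) simp_all
qed simp_all

text \<open>Pascal's rule splits each coefficient, so the two neighbouring windows, from
  \<open>i\<close> and from \<open>i + 1\<close>, combine into the longer one.\<close>

lemma pascal_sum:
  fixes a :: "int \<Rightarrow> rat"
  shows "(\<Sum>j=0..Suc n. of_nat (Suc n choose j) * a (i + int j)) =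
    (\<Sum>j=0..n. of_nat (n choose j) * a (i + int j)) +
    (\<Sum>j=0..n. of_nat (n choose j) * a (i + 1 + int j))"
proof -
  have "(\<Sum>j=0..Suc n. of_nat (Suc n choose j) * a (i + int j)) =
      a i + (\<Sum>j=0..n. of_nat (n choose Suc j) * a (i + int (Suc j)))
        + (\<Sum>j=0..n. of_nat (n choose j) * a (i + 1 + int j))"
    by (subst sum.atLeast0_atMost_Suc_shift)
      (simp add: sum.distrib[symmetric] algebra_simps)
  \<comment> \<open>\<open>a i\<close> becomes the term \<open>j = 0\<close>; the top term has
    coefficient \<open>n choose Suc n\<close>, which is 0, and drops out next.\<close>
  also have "a i + (\<Sum>j=0..n. of_nat (n choose Suc j) * a (i + int (Suc j))) =
      (\<Sum>j=0..Suc n. of_nat (n choose j) * a (i + int j))"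
    by (subst sum.atLeast0_atMost_Suc_shift) simp
  also have "\<dots> = (\<Sum>j=0..n. of_nat (n choose j) * a (i + int j))"
    by simp
  finally show ?thesis .
qed

lemma pascal_prod:
  fixes a :: "int \<Rightarrow> rat"
  shows "(\<Prod>j=0..Suc n. a (i + int j) ^ (Suc n choose j)) =
    (\<Prod>j=0..n. a (i + int j) ^ (n choose j)) * (\<Prod>j=0..n. a (i + 1 + int j) ^ (n choose j))"
proof -
  have "(\<Prod>j=0..Suc n. a (i + int j) ^ (Suc n choose j)) =
      a i * (\<Prod>j=0..n. a (i + int (Suc j)) ^ (n choose Suc j))
        * (\<Prod>j=0..n. a (i + 1 + int j) ^ (n choose j))"
    by (subst prod.atLeast0_atMost_Suc_shift)
      (simp add: prod.distrib[symmetric] power_add algebra_simps)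
  also have "a i * (\<Prod>j=0..n. a (i + int (Suc j)) ^ (n choose Suc j)) =
      (\<Prod>j=0..Suc n. a (i + int j) ^ (n choose j))"
    by (subst prod.atLeast0_atMost_Suc_shift) simp
  also have "\<dots> = (\<Prod>j=0..n. a (i + int j) ^ (n choose j))"
    by (simp add: binomial_eq_0)
  finally show ?thesis .
qed

text \<open>The map \<open>c * \<phi>\<close> is a genuine character, and the factors
  \<open>c\<close> inside the product cancel in pairs because the binomial exponents sum to an even
  number, a positive power of 2. After 0 steps this parity argument breaks down, hence
  \<open>Suc n\<close>.\<close>

lemma twisted_character_orbit:
  fixes \<phi> :: "rat \<Rightarrow> rat"
  assumes f: "closed_rule f" and x: "x \<in> configurations"
    and hom: "\<And>u v. u \<in> alphabet \<Longrightarrow> v \<in> alphabet \<Longrightarrow> \<phi> (f u v) = c * (\<phi> u * \<phi> v)"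
    and c: "c * c = 1"
  shows "\<phi> ((global_map f ^^ Suc n) x i) = c * (\<Prod>j=0..Suc n. \<phi> (x (i + int j)) ^ (Suc n choose j))"
proof (induction n arbitrary: i)
  case 0
  show ?case
    using hom x by (simp add: global_map_def configurationsD)
next
  case (Suc n)
  let ?G = "\<lambda>i. \<Prod>j=0..Suc n. \<phi> (x (i + int j)) ^ (Suc n choose j)"
  have "\<phi> ((global_map f ^^ Suc (Suc n)) x i) = c * ((c * ?G i) * (c * ?G (i + 1)))"
    by (subst global_map_funpow_Suc) (simp only: hom orbit_in_alphabet[OF f x] Suc.IH)
  also have "\<dots> = (c * c) * c * (?G i * ?G (i + 1))"
    by (simp only: ac_simps)
  also have "\<dots> = c * (?G i * ?G (i + 1))"
    by (simp only: c mult_1)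
  finally show ?case
    by (simp only: pascal_prod[of "\<lambda>k. \<phi> (x k)"])
qed

lemma character_orbit:
  fixes \<phi> :: "rat \<Rightarrow> rat"
  assumes f: "closed_rule f" and x: "x \<in> configurations"
    and hom: "\<And>u v. u \<in> alphabet \<Longrightarrow> v \<in> alphabet \<Longrightarrow> \<phi> (f u v) = \<phi> u * \<phi> v"
    and idem: "\<And>u. u \<in> alphabet \<Longrightarrow> \<phi> u \<in> {0, 1}"
  shows "\<phi> ((global_map f ^^ n) x i) = (\<Prod>j=0..n. \<phi> (x (i + int j)))"
proof (cases n)
  case (Suc m)
  have "\<phi> (x (i + int j)) ^ (n choose j) = \<phi> (x (i + int j))" if "j \<le> n" for j
  proof -
    have "\<phi> (x (i + int j)) \<in> {0, 1}"
      using idem x by (simp add: configurationsD)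
    \<comment> \<open>Positivity excludes the exponent 0, where \<open>0 ^ 0 = 1\<close> would
      differ from the base.\<close>
    moreover have "0 < n choose j"
      using that by simp
    ultimately show ?thesis by auto
  qed
  then show ?thesis
    using twisted_character_orbit[OF f x, of \<phi> 1 m i] hom Suc by simp
qed simp

lemma quasi_band_orbit:
  assumes f: "closed_rule f" and x: "x \<in> configurations"
    and abby: "\<And>a b y. a \<in> alphabet \<Longrightarrow> b \<in> alphabet \<Longrightarrow> y \<in> alphabet \<Longrightarrow>
      f (f a b) (f b y) = f a (f b y)"
  shows "(global_map f ^^ Suc n) x i = f (x i) ((global_map f ^^ n) x (i + 1))"
  using x
proof (induction n arbitrary: x i)
  case 0
  show ?case by (simp add: global_map_def)
next
  case (Suc n)
  let ?y = "(global_map f ^^ n) x (i + 1 + 1)"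
  have step: "(global_map f ^^ Suc n) x (i + 1) = f (x (i + 1)) ?y"
    by (rule Suc.IH[OF Suc.prems])
  \<comment> \<open>The induction hypothesis is used for the image configuration
    \<open>global_map f x\<close> as well, so it has to hold for arbitrary \<open>x\<close>.\<close>
  have "(global_map f ^^ Suc (Suc n)) x i =
      f (global_map f x i) ((global_map f ^^ Suc n) x (i + 1))"
    using Suc.IH[OF global_map_in_configurations[OF f Suc.prems]]
    by (simp only: funpow_Suc_right o_apply)
  also have "\<dots> = f (f (x i) (x (i + 1))) (f (x (i + 1)) ?y)"
    by (simp only: step) (simp add: global_map_def)
  also have "\<dots> = f (x i) (f (x (i + 1)) ?y)"
    by (intro abby configurationsD Suc.prems orbit_in_configurations f)
  finally show ?case by (simp only: step)
qed

section \<open>Explicit orbits of the individual rules\<close>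

lemma mod3_add: "a \<in> \<int> \<Longrightarrow> b \<in> \<int> \<Longrightarrow> mod3 (mod3 a + mod3 b) = mod3 (a + b)"
  by (elim Ints_cases) (simp add: mod3_def mod_add_eq flip: of_int_add)

lemma orbit_f1:
  assumes x: "x \<in> configurations"
  shows "(global_map f1 ^^ n) x i = mod3 (\<Sum>j=0..n. of_nat (n choose j) * x (i + int j))"
proof (induction n arbitrary: i)
  case 0
  show ?case
    using configurationsD[OF x, of i] by (auto simp: alphabet_def mod3_def)
next
  case (Suc n)
  \<comment> \<open>\<open>mod3\<close> goes through the floor, which respects sums of integral
    values.\<close>
  have "x k \<in> \<int>" for k
    using configurationsD[OF x, of k] by (auto simp: alphabet_def)
  then have "(\<Sum>j=0..n. of_nat (n choose j) * x (k + int j)) \<in> \<int>" for k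
    by (intro Ints_sum Ints_mult) auto
  then show ?case
    by (subst global_map_funpow_Suc) (simp only: Suc.IH f1_def mod3_add pascal_sum)
qed

text \<open>The character \<open>u^2 - u - 1\<close> is -1 at 0 and 1, and 1 at 2.\<close>

lemma orbit_f2:
  assumes x: "x \<in> configurations"
  shows "(global_map f2 ^^ Suc n) x i =
    1 + (\<Prod>j=0..Suc n. ((x (i + int j))^2 - x (i + int j) - 1) ^ (Suc n choose j))"
proof -
  have f: "closed_rule f2" by (rule closed_ruleI) simp
  \<comment> \<open>\<open>f2\<close> takes only the values 0 and 2, where the character determines
    the state; at state 1 the identity would fail.\<close>
  have "f2 u v = 1 + ((f2 u v)^2 - f2 u v - 1)" if "u \<in> alphabet" "v \<in> alphabet" for u v
    using that by (auto simp: alphabet_def f2_def power2_eq_square)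
  then have "(global_map f2 ^^ Suc n) x i =
      1 + (((global_map f2 ^^ Suc n) x i)^2 - (global_map f2 ^^ Suc n) x i - 1)"
    unfolding global_map_funpow_Suc using orbit_in_alphabet[OF f x] by blast
  also have "((global_map f2 ^^ Suc n) x i)^2 - (global_map f2 ^^ Suc n) x i - 1 =
      1 * (\<Prod>j=0..Suc n. ((x (i + int j))^2 - x (i + int j) - 1) ^ (Suc n choose j))"
    by (rule twisted_character_orbit[OF f x])
      (auto simp: alphabet_def f2_def power2_eq_square)
  finally show ?thesis by (simp only: mult_1)
qed

text \<open>\<open>f3\<close> vanishes unless both arguments are 1, and never takes the value 1
  itself.\<close>

lemma orbit_f3:
  assumes x: "x \<in> configurations"
  shows "(global_map f3 ^^ Suc n) x i = (if n = 0 then f3 (x i) (x (i + 1)) else 0)"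
proof -
  have f: "closed_rule f3" by (rule closed_ruleI) simp
  show ?thesis
  proof (cases n)
    case 0
    then show ?thesis by (simp add: global_map_def)
  next
    case (Suc m)
    have *: "f3 (f3 a b) (f3 b c) = 0"
      if "a \<in> alphabet" "b \<in> alphabet" "c \<in> alphabet" for a b c
      using that by (auto simp: alphabet_def f3_def)
    have "(global_map f3 ^^ Suc (Suc m)) x i = 0"
      unfolding global_map_funpow_Suc by (intro * orbit_in_alphabet f x)
    then show ?thesis using Suc by simp
  qed
qed

lemma orbit_f4:
  assumes x: "x \<in> configurations"
  shows "(global_map f4 ^^ Suc n) x i =
    1 + (\<Prod>j=0..Suc n. (x (i + int j) - 1) ^ (Suc n choose j))"
proof -
  have f: "closed_rule f4" by (rule closed_ruleI) simp
  have "(global_map f4 ^^ Suc n) x i - 1 =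
      1 * (\<Prod>j=0..Suc n. (x (i + int j) - 1) ^ (Suc n choose j))"
    by (rule twisted_character_orbit[OF f x]) (simp_all add: f4_def)
  then show ?thesis by (simp only: mult_1 eq_diff_eq diff_eq_eq ac_simps)
qed

text \<open>The sign map \<open>u^2 - 3 * u + 1\<close>, equal to 1 at 0 and to -1 at 1 and 2, is a
  character twisted by \<open>c = -1\<close>. It does not separate 1 from 2; the second character
  \<open>u * (2 - u)\<close>, the indicator of 1, does.\<close>

lemma orbit_f5:
  assumes x: "x \<in> configurations"
  shows "(global_map f5 ^^ Suc n) x i =
    1 + (\<Prod>j=0..Suc n. ((x (i + int j))^2 - 3 * x (i + int j) + 1) ^ (Suc n choose j))
      - (\<Prod>j=0..Suc n. x (i + int j) * (2 - x (i + int j)))"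
proof -
  have f: "closed_rule f5" by (rule closed_ruleI) simp
  let ?w = "(global_map f5 ^^ Suc n) x i"
  have "?w^2 - 3 * ?w + 1 =
      - 1 * (\<Prod>j=0..Suc n. ((x (i + int j))^2 - 3 * x (i + int j) + 1) ^ (Suc n choose j))"
    by (rule twisted_character_orbit[OF f x])
      (auto simp: alphabet_def f5_def power2_eq_square)
  moreover have "?w * (2 - ?w) = (\<Prod>j=0..Suc n. x (i + int j) * (2 - x (i + int j)))"
    by (rule character_orbit[OF f x]) (auto simp: alphabet_def f5_def)
  moreover have "?w = 1 - (?w^2 - 3 * ?w + 1) - ?w * (2 - ?w)"
    using orbit_in_alphabet[OF f x, of "Suc n" i]
    by (elim alphabet_cases) (simp_all del: funpow.simps)
  ultimately show ?thesis by linarith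
qed

text \<open>The sign map is the one used for \<open>f5\<close>, again twisted by -1. Since
  \<open>f6\<close> never takes the value 1, the sign alone determines the state.\<close>

lemma orbit_f6:
  assumes x: "x \<in> configurations"
  shows "(global_map f6 ^^ Suc n) x i =
    1 + (\<Prod>j=0..Suc n. ((x (i + int j))^2 - 3 * x (i + int j) + 1) ^ (Suc n choose j))"
proof -
  have f: "closed_rule f6" by (rule closed_ruleI) simp
  have "f6 u v = 1 - ((f6 u v)^2 - 3 * f6 u v + 1)"
    if "u \<in> alphabet" "v \<in> alphabet" for u v
    using that by (auto simp: alphabet_def f6_def power2_eq_square)
  then have "(global_map f6 ^^ Suc n) x i =
      1 - (((global_map f6 ^^ Suc n) x i)^2 - 3 * (global_map f6 ^^ Suc n) x i + 1)"
    unfolding global_map_funpow_Suc using orbit_in_alphabet[OF f x] by blast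
  moreover have "((global_map f6 ^^ Suc n) x i)^2 - 3 * (global_map f6 ^^ Suc n) x i + 1 =
      - 1 * (\<Prod>j=0..Suc n. ((x (i + int j))^2 - 3 * x (i + int j) + 1) ^ (Suc n choose j))"
    by (rule twisted_character_orbit[OF f x])
      (auto simp: alphabet_def f6_def power2_eq_square)
  ultimately show ?thesis by linarith
qed

lemma orbit_f8:
  assumes x: "x \<in> configurations"
  shows "(global_map f8 ^^ Suc n) x i = (\<Prod>j=0..Suc n. x (i + int j) * (2 - x (i + int j)))"
proof -
  have f: "closed_rule f8" by (rule closed_ruleI) simp
  have "f8 u v = f8 u v * (2 - f8 u v)" if "u \<in> alphabet" "v \<in> alphabet" for u v
    using that by (auto simp: alphabet_def f8_def)
  then have "(global_map f8 ^^ Suc n) x i =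
      (global_map f8 ^^ Suc n) x i * (2 - (global_map f8 ^^ Suc n) x i)"
    unfolding global_map_funpow_Suc using orbit_in_alphabet[OF f x] by blast
  also have "\<dots> = (\<Prod>j=0..Suc n. x (i + int j) * (2 - x (i + int j)))"
    by (rule character_orbit[OF f x]) (auto simp: alphabet_def f8_def)
  finally show ?thesis .
qed

text \<open>The character is the indicator of a nonzero state, and \<open>f9\<close> takes only the
  values 0 and 1.\<close>

lemma orbit_f9:
  assumes x: "x \<in> configurations"
  shows "(global_map f9 ^^ Suc n) x i =
    (\<Prod>j=0..Suc n. 1/2 * x (i + int j) * (3 - x (i + int j)))"
proof -
  have f: "closed_rule f9" by (rule closed_ruleI) simp
  have "f9 u v = 1/2 * f9 u v * (3 - f9 u v)" if "u \<in> alphabet" "v \<in> alphabet" for u v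
    using that by (auto simp: alphabet_def f9_def)
  then have "(global_map f9 ^^ Suc n) x i =
      1/2 * (global_map f9 ^^ Suc n) x i * (3 - (global_map f9 ^^ Suc n) x i)"
    unfolding global_map_funpow_Suc using orbit_in_alphabet[OF f x] by blast
  also have "\<dots> = (\<Prod>j=0..Suc n. 1/2 * x (i + int j) * (3 - x (i + int j)))"
    by (rule character_orbit[OF f x]) (auto simp: alphabet_def f9_def)
  finally show ?thesis .
qed

text \<open>State 1 is an identity on the alphabet and 2 squares to 0. Interior cells enter with
  multiplicity at least 2, so each must be 1 for a nonzero result; the two end cells enter
  once.\<close>

lemma orbit_f10:
  assumes x: "x \<in> configurations"
  shows "(global_map f10 ^^ Suc n) x i =
    f10 (x i) (x (i + int (Suc n))) * (\<Prod>j=1..n. x (i + int j) * (2 - x (i + int j)))"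
proof (induction n arbitrary: i)
  case 0
  show ?case by (simp add: global_map_def)
next
  case (Suc n)
  let ?o = "\<lambda>u::rat. u * (2 - u)"
  show ?case
  proof (cases n)
    case 0
    \<comment> \<open>With two steps the cells \<open>b\<close> and \<open>c\<close> of the general
      case below coincide, so this case is checked separately.\<close>
    have "f10 (f10 a b) (f10 b c) = f10 a c * ?o b"
      if "a \<in> alphabet" "b \<in> alphabet" "c \<in> alphabet" for a b c
      using that by (auto simp: alphabet_def f10_def)
    then show ?thesis
      using 0 configurationsD[OF x] by (simp add: global_map_def add.assoc)
  next
    case (Suc m)
    \<comment> \<open>\<open>p\<close> collects the cells interior to both windows, the one from
      \<open>i\<close> and the one from \<open>i + 1\<close>.\<close>
    define p where "p = (\<Prod>j=2..n. ?o (x (i + int j)))"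
    have "?o (x k) \<in> {0, 1}" for k
      using configurationsD[OF x, of k] by (auto simp: alphabet_def)
    then have "p \<in> {0, 1}"
      unfolding p_def by (intro prod_zero_one)
    then have p: "p = 0 \<or> p = 1"
      by simp
    \<comment> \<open>Here \<open>b\<close> and \<open>c\<close> are each an end of one window and
      interior to the other. If an indicator or \<open>p'\<close> is 0, both sides vanish; otherwise
      \<open>b = c = 1\<close> acts as the identity.\<close>
    have "f10 (f10 a c * (?o b * p')) (f10 b d * (p' * ?o c)) = f10 a d * (?o b * p' * ?o c)"
      if "a \<in> alphabet" "b \<in> alphabet" "c \<in> alphabet" "d \<in> alphabet" "p' = 0 \<or> p' = 1"
      for a b c d p'
      using that by (auto simp: alphabet_def f10_def)
    then have "f10 (f10 (x i) (x (i + int (Suc n))) * (?o (x (i + 1)) * p))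
        (f10 (x (i + 1)) (x (i + 1 + int (Suc n))) * (p * ?o (x (i + int (Suc n))))) =
        f10 (x i) (x (i + 1 + int (Suc n))) * (?o (x (i + 1)) * p * ?o (x (i + int (Suc n))))"
      using p configurationsD[OF x] by blast
    moreover have "(\<Prod>j=1..n. ?o (x (i + int j))) = ?o (x (i + 1)) * p"
      unfolding p_def using Suc by (subst prod.atLeast_Suc_atMost) (simp_all add: numeral_2_eq_2)
    moreover have "(\<Prod>j=1..n. ?o (x (i + 1 + int j))) = p * ?o (x (i + int (Suc n)))"
    proof -
      have "(\<Prod>j=1..n. ?o (x (i + 1 + int j))) = (\<Prod>j=2..Suc n. ?o (x (i + int j)))"
        using prod.shift_bounds_cl_Suc_ivl[of "\<lambda>j. ?o (x (i + int j))" 1 n]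
        by (simp add: add.assoc numeral_2_eq_2 del: prod.cl_ivl_Suc)
      then show ?thesis
        unfolding p_def using Suc by simp
    qed
    moreover have "(\<Prod>j=1..Suc n. ?o (x (i + int j))) =
        (\<Prod>j=1..n. ?o (x (i + int j))) * ?o (x (i + int (Suc n)))"
      by simp
    moreover have "i + int (Suc (Suc n)) = i + 1 + int (Suc n)"
      by simp
    ultimately show ?thesis
      by (subst global_map_funpow_Suc) (simp only: Suc.IH)
  qed
qed

text \<open>The right neighbour is ignored, and the map fixing 1 and sending 0 and 2 to 2 is
  idempotent.\<close>

lemma orbit_f11:
  assumes x: "x \<in> configurations"
  shows "(global_map f11 ^^ Suc n) x i = 1 + (x i - 1)^2"
proof (induction n)
  case 0
  show ?case by (simp add: global_map_def f11_def)
next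
  case (Suc n)
  have "1 + (1 + (x i - 1)^2 - 1)^2 = 1 + (x i - 1)^2"
    using configurationsD[OF x, of i] by (elim alphabet_cases) simp_all
  then show ?case
    by (subst global_map_funpow_Suc) (simp only: Suc.IH f11_def)
qed

text \<open>On the alphabet, \<open>f12 u v\<close> is \<open>v\<close> if \<open>u = 1\<close> and
  0 otherwise, so each recursion step contributes one indicator of state 1.\<close>

lemma orbit_f12:
  assumes x: "x \<in> configurations"
  shows "(global_map f12 ^^ Suc n) x i =
    x (i + int (Suc n)) * (\<Prod>j=0..n. x (i + int j) * (2 - x (i + int j)))"
proof (induction n arbitrary: i)
  case 0
  show ?case by (simp add: global_map_def f12_def)
next
  case (Suc n)
  have f: "closed_rule f12" by (rule closed_ruleI) simp
  have "(global_map f12 ^^ Suc (Suc n)) x i = f12 (x i) ((global_map f12 ^^ Suc n) x (i + 1))"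
    by (rule quasi_band_orbit[OF f x]) (auto simp: alphabet_def f12_def)
  also have "\<dots> = x (i + 1 + int (Suc n)) * (x i * (2 - x i) *
      (\<Prod>j=0..n. x (i + 1 + int j) * (2 - x (i + 1 + int j))))"
    unfolding Suc.IH f12_def by (simp only: ac_simps)
  also have "\<dots> = x (i + int (Suc (Suc n))) * (\<Prod>j=0..Suc n. x (i + int j) * (2 - x (i + int j)))"
    unfolding prod_head[of "\<lambda>k. x k * (2 - x k)"] by (simp add: algebra_simps)
  finally show ?case .
qed

lemma orbit_f13:
  assumes x: "x \<in> configurations"
  shows "(global_map f13 ^^ n) x i = Max ((\<lambda>j. x (i + int j)) ` {0..n})"
proof (induction n arbitrary: i)
  case (Suc n)
  have f: "closed_rule f13" by (rule closed_ruleI) simp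
  have "(global_map f13 ^^ Suc n) x i = f13 (x i) ((global_map f13 ^^ n) x (i + 1))"
    by (rule quasi_band_orbit[OF f x]) (auto simp: f13_def)
  also have "\<dots> = Max (insert (x i) ((\<lambda>j. x (i + 1 + int j)) ` {0..n}))"
    unfolding Suc.IH f13_def by (subst Max_insert) auto
  also have "insert (x i) ((\<lambda>j. x (i + 1 + int j)) ` {0..n}) = (\<lambda>j. x (i + int j)) ` {0..Suc n}"
    unfolding atLeast0_atMost_Suc_eq_insert_0 by (simp add: image_image add.assoc del: image_Suc_atLeastAtMost)
  finally show ?case .
qed simp

text \<open>\<open>f14\<close> returns the common value of equal arguments and 0 otherwise, so the
  indicators of 1 and of 2 are both characters, and together they recover the state.\<close>

lemma orbit_f14:
  assumes x: "x \<in> configurations"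
  shows "(global_map f14 ^^ n) x i =
    (\<Prod>j=0..n. x (i + int j) * (2 - x (i + int j)))
      + 2 * (\<Prod>j=0..n. 1/2 * x (i + int j) * (x (i + int j) - 1))"
proof -
  have f: "closed_rule f14" by (rule closed_ruleI) simp
  let ?w = "(global_map f14 ^^ n) x i"
  have "?w * (2 - ?w) = (\<Prod>j=0..n. x (i + int j) * (2 - x (i + int j)))"
    by (rule character_orbit[OF f x]) (auto simp: alphabet_def f14_def)
  moreover have "1/2 * ?w * (?w - 1) = (\<Prod>j=0..n. 1/2 * x (i + int j) * (x (i + int j) - 1))"
    by (rule character_orbit[OF f x]) (auto simp: alphabet_def f14_def)
  moreover have "?w = ?w * (2 - ?w) + 2 * (1/2 * ?w * (?w - 1))"
    by (simp add: field_simps)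
  ultimately show ?thesis by simp
qed

text \<open>A left argument 0 or 1 is kept, while 2 survives only next to 2 and otherwise becomes 0.
  The indicator of 2 is a character, that of 1 is not; the one-sided recursion supplies the latter's
  contribution.\<close>

lemma orbit_f15:
  assumes x: "x \<in> configurations"
  shows "(global_map f15 ^^ Suc n) x i =
    x i * (2 - x i) + 2 * (\<Prod>j=0..Suc n. 1/2 * x (i + int j) * (x (i + int j) - 1))"
proof -
  have f: "closed_rule f15" by (rule closed_ruleI) simp
  let ?y = "(global_map f15 ^^ n) x (i + 1)"
  have "(global_map f15 ^^ Suc n) x i = f15 (x i) ?y"
    by (rule quasi_band_orbit[OF f x]) (auto simp: alphabet_def f15_def)
  also have "\<dots> = x i * (2 - x i) + 2 * ((1/2 * x i * (x i - 1)) * (1/2 * ?y * (?y - 1)))"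
    using configurationsD[OF x, of i] orbit_in_alphabet[OF f x, of n "i + 1"]
    by (elim alphabet_cases) (simp_all add: f15_def)
  also have "1/2 * ?y * (?y - 1) =
      (\<Prod>j=0..n. 1/2 * x (i + 1 + int j) * (x (i + 1 + int j) - 1))"
    by (rule character_orbit[OF f x]) (auto simp: alphabet_def f15_def)
  finally show ?thesis
    by (simp only: prod_head[of "\<lambda>k. 1/2 * x k * (x k - 1)"])
qed

text \<open>The left argument is kept unless the right one is 1, which forces 1. Thus
  \<open>(u - 1)^2\<close>, the indicator of \<open>u\<close> differing from 1, is a character; the
  recursion adds the sign carried by \<open>x i - 1\<close>.\<close>

lemma orbit_f16:
  assumes x: "x \<in> configurations"
  shows "(global_map f16 ^^ Suc n) x i = 1 + (x i - 1) * (\<Prod>j=1..Suc n. (x (i + int j) - 1)^2)"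
proof -
  have f: "closed_rule f16" by (rule closed_ruleI) simp
  let ?y = "(global_map f16 ^^ n) x (i + 1)"
  have "(global_map f16 ^^ Suc n) x i = 1 + (?y - 1)^2 * (x i - 1)"
    unfolding f16_def[symmetric]
    by (rule quasi_band_orbit[OF f x]) (auto simp: alphabet_def f16_def)
  also have "(?y - 1)^2 = (\<Prod>j=0..n. (x (i + 1 + int j) - 1)^2)"
    by (rule character_orbit[OF f x]) (auto simp: alphabet_def f16_def)
  also have "\<dots> = (\<Prod>j=1..Suc n. (x (i + int j) - 1)^2)"
    using prod.shift_bounds_cl_Suc_ivl[of "\<lambda>j. (x (i + int j) - 1)^2" 0 n]
    by (simp add: add.assoc)
  finally show ?thesis by (simp add: mult.commute)
qed

text \<open>On a configuration, \<open>H x i m\<close> indicates that the cells before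
  \<open>i + m\<close> in the window are all 2 and that cell \<open>i + m\<close> is 1; the first of
  these 2s is split off.\<close>

lemma H_Suc: "H x i (Suc m) = (1/2 * x i * (x i - 1)) * H x (i + 1) m"
proof (cases m)
  case (Suc k)
  have "i + int (Suc m) = i + 1 + int m"
    by simp
  then show ?thesis
    unfolding H_def Suc diff_Suc_1 prod_head[of "\<lambda>k. 1/2 * x k * (x k - 1)"]
    by (simp add: ac_simps del: prod.cl_ivl_Suc)
qed (simp add: H_def)

text \<open>If \<open>x i\<close> is 0, every \<open>H x i k\<close> vanishes; if it is 1, the
  factor at \<open>k = 0\<close> vanishes; if it is 2, everything passes to the window from
  \<open>i + 1\<close>.\<close>

lemma H_product_Suc:
  assumes "x i \<in> alphabet"
  shows "1 - (\<Prod>k=0..Suc n. (1 - H x i k)) =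
    x i * (2 - x i) + (1/2 * x i * (x i - 1)) * (1 - (\<Prod>k=0..n. (1 - H x (i + 1) k)))"
  unfolding prod.atLeast0_atMost_Suc_shift o_def H_Suc
  using assms by (elim alphabet_cases) (simp_all add: H_def)

text \<open>A left argument 0 or 1 is kept and \<open>f18 2 v = v\<close>, so the state is the first
  entry of the window other than 2, or 2 if there is none. The \<open>H\<close> part accounts for
  the value 1, the last product for the value 2.\<close>

lemma orbit_f18:
  assumes x: "x \<in> configurations"
  shows "(global_map f18 ^^ n) x i =
    1 - (\<Prod>k=0..n. (1 - H x i k))
      + 2 * (\<Prod>j=0..n. 1/2 * x (i + int j) * (x (i + int j) - 1))"
proof (induction n arbitrary: i)
  case 0
  show ?case by (simp add: H_def field_simps)
next
  case (Suc n)
  have f: "closed_rule f18" by (rule closed_ruleI) simp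
  let ?y = "(global_map f18 ^^ n) x (i + 1)"
  have "(global_map f18 ^^ Suc n) x i = f18 (x i) ?y"
    by (rule quasi_band_orbit[OF f x]) (auto simp: alphabet_def f18_def)
  also have "\<dots> = x i * (2 - x i) + (1/2 * x i * (x i - 1)) * ?y"
    using configurationsD[OF x, of i] by (elim alphabet_cases) (simp_all add: f18_def)
  also have "\<dots> = 1 - (\<Prod>k=0..Suc n. (1 - H x i k))
      + 2 * (\<Prod>j=0..Suc n. 1/2 * x (i + int j) * (x (i + int j) - 1))"
    unfolding Suc.IH H_product_Suc[of x i, OF configurationsD[OF x]]
      prod_head[of "\<lambda>k. 1/2 * x k * (x k - 1)"]
    by (simp only: distrib_left ac_simps)
  finally show ?case .
qed

theorem mainTheorem1:
  fixes x :: "int \<Rightarrow> rat" and i :: int and n :: nat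
  assumes "x \<in> configurations" and "n \<ge> 1"
  shows
    "((global_map f1 ^^ n) x i = mod3 (\<Sum>j=0..n. of_nat (n choose j) * x (i + int j))) \<and>
     ((global_map f2 ^^ n) x i =
      1 + (\<Prod>j=0..n. ((x (i + int j))^2 - x (i + int j) - 1) ^ (n choose j))) \<and>
     ((global_map f3 ^^ n) x i =
      (if n = 1 then 2 * x i * (x i - 2) * x (i + 1) * (x (i + 1) - 2) else 0)) \<and>
     ((global_map f4 ^^ n) x i = 1 + (\<Prod>j=0..n. (x (i + int j) - 1) ^ (n choose j))) \<and>
     ((global_map f5 ^^ n) x i =
      1 + (\<Prod>j=0..n. ((x (i + int j))^2 - 3 * x (i + int j) + 1) ^ (n choose j))
        - (\<Prod>j=0..n. x (i + int j) * (2 - x (i + int j)))) \<and>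
     ((global_map f6 ^^ n) x i =
      1 + (\<Prod>j=0..n. ((x (i + int j))^2 - 3 * x (i + int j) + 1) ^ (n choose j))) \<and>
     ((global_map f7 ^^ n) x i = 2) \<and>
     ((global_map f8 ^^ n) x i = (\<Prod>j=0..n. x (i + int j) * (2 - x (i + int j)))) \<and>
     ((global_map f9 ^^ n) x i = (\<Prod>j=0..n. 1/2 * x (i + int j) * (3 - x (i + int j)))) \<and>
     ((global_map f10 ^^ n) x i =
      x i * x (i + int n) * (x i + x (i + int n) - x i * x (i + int n)) *
        (\<Prod>j=1..n-1. x (i + int j) * (2 - x (i + int j)))) \<and>
     ((global_map f11 ^^ n) x i = 1 + (x i - 1)^2) \<and>
     ((global_map f12 ^^ n) x i =
      x (i + int n) * (\<Prod>j=0..n-1. x (i + int j) * (2 - x (i + int j)))) \<and>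
     ((global_map f13 ^^ n) x i = Max ((\<lambda>j. x (i + int j)) ` {0..n})) \<and>
     ((global_map f14 ^^ n) x i =
      (\<Prod>j=0..n. x (i + int j) * (2 - x (i + int j)))
        + 2 * (\<Prod>j=0..n. 1/2 * x (i + int j) * (x (i + int j) - 1))) \<and>
     ((global_map f15 ^^ n) x i =
      x i * (2 - x i) + 2 * (\<Prod>j=0..n. 1/2 * x (i + int j) * (x (i + int j) - 1))) \<and>
     ((global_map f16 ^^ n) x i =
      1 + (x i - 1) * (\<Prod>j=1..n. (x (i + int j) - 1)^2)) \<and>
     ((global_map f17 ^^ n) x i = x i) \<and>
     ((global_map f18 ^^ n) x i =
      1 - (\<Prod>k=0..n. (1 - H x i k))
        + 2 * (\<Prod>j=0..n. 1/2 * x (i + int j) * (x (i + int j) - 1)))"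
proof -
  \<comment> \<open>Several formulae, such as the one for \<open>f7\<close>, can fail at 0 steps, so
    their orbit lemmas start at \<open>Suc\<close>.\<close>
  obtain m where n: "n = Suc m"
    using assms(2) by (cases n) auto
  have f7: "(global_map f7 ^^ n) x i = 2"
    by (simp add: n global_map_def f7_def)
  have f17: "(global_map f17 ^^ n) x i = x i"
    by (induction n) (simp_all add: global_map_def f17_def)
  note orbits = orbit_f1 orbit_f2 orbit_f3 orbit_f4 orbit_f5 orbit_f6 orbit_f8 orbit_f9 orbit_f10
    orbit_f11 orbit_f12 orbit_f13 orbit_f14 orbit_f15 orbit_f16 orbit_f18
  show ?thesis
    using f7 f17 unfolding n
    \<comment> \<open>The deleted rules would unfold \<open>Suc m\<close> in the iterates, products,
      sums and binomials, and the orbit lemmas would no longer match.\<close>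
    by (simp add: orbits[OF assms(1)] f3_def f10_def
        del: funpow.simps prod.cl_ivl_Suc sum.cl_ivl_Suc binomial_Suc_Suc)
qed

end
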